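(* Let $n_1,n_2>0$ with $n_1+n_2>\pi$. Then there exist traceless real $2\times2$ matrices $A_1,A_2$ such that $\|A_1\|_2=n_1$, $\|A_2\|_2=n_2$, and the Magnus (BCH) expansion of $A_1,A_2$ is divergent, with convergence radius less than $1$. Likewise, there exist complex skew-Hermitian $2\times2$ matrices $A_1,A_2$ such that $\|A_1\|_2=n_1$, $\|A_2\|_2=n_2$, and the Magnus (BCH) expansion of $A_1,A_2$ is divergent, with convergence radius less than $1$.
   Context: $\|\cdot\|_2$ is the operator norm induced by the Euclidean norm. The Magnus (BCH) expansion of $A_1,A_2$ is the series $\sum_{n\ge1}\mu_n$, where $\log(\exp(tA_1)\exp(tA_2))=\sum_{n\ge1}\mu_nt^n$ for small $|t|$ ($\log$ being the principal logarithm, defined for matrices with no eigenvalue in $(-\infty,0]$). Its convergence radius is the convergence radius of $\sum_n\mu_nt^n$ in $t$. *)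

theory Defs
  imports "HOL-Analysis.Analysis"
begin

text \<open>Matrices are the types \<^typ>\<open>real^'n^'n\<close> and \<^typ>\<open>complex^'n^'n\<close>, with matrix
  product \<^term>\<open>(**)\<close> (the type-class product of vectors is componentwise, so the
  type-class powers and \<^const>\<open>exp\<close> are not the matrix ones). The norm of
  \<^typ>\<open>real^'n\<close> and of \<^typ>\<open>complex^'n\<close> is Euclidean, so \<open>onorm ((*v) A)\<close> is the operator
  norm \<open>\<parallel>A\<parallel>\<^sub>2\<close>. Exponentials and logarithms of real matrices are taken after the
  embedding \<open>map_matrix complex_of_real\<close>.\<close>

definition matrix_power :: "complex^'n^'n \<Rightarrow> nat \<Rightarrow> complex^'n^'n" where
  "matrix_power A k = (((**) A) ^^ k) (mat 1)"

definition matrix_exp :: "complex^'n^'n \<Rightarrow> complex^'n^'n" where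
  "matrix_exp A = (\<Sum>k. (1 / fact k) *\<^sub>R matrix_power A k)"

definition matrix_eigenvalue :: "complex^'n^'n \<Rightarrow> complex \<Rightarrow> bool" where
  "matrix_eigenvalue A z \<longleftrightarrow> (\<exists>v. v \<noteq> 0 \<and> A *v v = z *s v)"

text \<open>For \<open>M\<close> without eigenvalues in \<open>(-\<infinity>,0]\<close>, the principal logarithm is the unique
  matrix \<open>L\<close> with \<open>exp L = M\<close> whose eigenvalues all lie in the open strip
  \<open>-\<pi> < Im z < \<pi>\<close>; the predicate below is the graph of that partial function.\<close>

definition is_principal_log :: "complex^'n^'n \<Rightarrow> complex^'n^'n \<Rightarrow> bool" where
  "is_principal_log M L \<longleftrightarrow>
     (\<forall>z. matrix_eigenvalue M z \<longrightarrow> z \<notin> \<real>\<^sub>\<le>\<^sub>0) \<and>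
     matrix_exp L = M \<and>
     (\<forall>z. matrix_eigenvalue L z \<longrightarrow> - pi < Im z \<and> Im z < pi)"

text \<open>\<open>\<mu>\<close> is the sequence of coefficients in
  \<open>log (exp (t A) exp (t B)) = (\<Sum>n\<ge>1. t^n \<mu>\<^sub>n)\<close> for all small real \<open>t\<close>; it is indexed
  from \<open>0\<close> with \<open>\<mu>\<^sub>0 = 0\<close>. The identity for small real \<open>t\<close> already determines \<open>\<mu>\<close>.\<close>

definition magnus_coeffs ::
    "complex^'n^'n \<Rightarrow> complex^'n^'n \<Rightarrow> (nat \<Rightarrow> complex^'n^'n) \<Rightarrow> bool" where
  "magnus_coeffs A B \<mu> \<longleftrightarrow>
     \<mu> 0 = 0 \<and>
     (\<exists>\<delta>>0. \<forall>t::real. \<bar>t\<bar> < \<delta> \<longrightarrow>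
        (\<exists>L. is_principal_log (matrix_exp (t *\<^sub>R A) ** matrix_exp (t *\<^sub>R B)) L \<and>
             (\<lambda>n. t ^ n *\<^sub>R \<mu> n) sums L))"

definition skew_hermitian :: "complex^'n^'n \<Rightarrow> bool" where
  "skew_hermitian A \<longleftrightarrow> (\<forall>i j. cnj (A $ j $ i) = - A $ i $ j)"

end

theory Submission
  imports Defs "HOL-Complex_Analysis.Complex_Analysis"
begin

text \<open>Let \<open>M(t) = exp (t A\<^sub>1) exp (t A\<^sub>2)\<close>. If the Magnus series had convergence radius greater
  than \<open>\<bar>t\<^sub>0\<bar>\<close>, its sum \<open>L\<close> would be a holomorphic traceless logarithm of \<open>M\<close> up to \<open>t\<^sub>0\<close>, by analytic
  continuation. A traceless \<open>2 \<times> 2\<close> matrix \<open>L\<close> with \<open>trace (exp L) = -2\<close> satisfies \<open>exp L = -1\<close>,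
  so every \<open>t\<^sub>0\<close> with \<open>trace (M t\<^sub>0) = -2\<close> and \<open>M t\<^sub>0 \<noteq> -1\<close> bounds the convergence radius.

  Such a \<open>t\<^sub>0\<close> with \<open>\<bar>t\<^sub>0\<bar> < 1\<close> is found near \<open>\<pi> / (n\<^sub>1 + n\<^sub>2)\<close> by perturbing two parallel rotations with
  speeds \<open>n\<^sub>1, n\<^sub>2\<close>, for which \<open>trace (M t) = 2 cos ((n\<^sub>1 + n\<^sub>2) t)\<close>. In the real case the second
  rotation is deformed to an elliptic one, and \<open>t\<^sub>0\<close> is real by the intermediate value theorem; in the
  skew-Hermitian case its axis is tilted, and \<open>t\<^sub>0\<close> is complex by Hurwitz's theorem.\<close>

no_notation fps_nth (infixl "$" 75)

section \<open>Entire functions giving the hyperbolic functions of a square root\<close>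

definition cosh_root_fps :: "complex fps" where
  "cosh_root_fps = Abs_fps (\<lambda>k. 1 / fact (2 * k))"

definition sinh_root_fps :: "complex fps" where
  "sinh_root_fps = Abs_fps (\<lambda>k. 1 / fact (2 * k + 1))"

text \<open>The entire functions with \<open>cosh_root (w\<^sup>2) = cosh w\<close> and \<open>w * sinh_root (w\<^sup>2) = sinh w\<close>.\<close>

definition cosh_root :: "complex \<Rightarrow> complex" where
  "cosh_root = eval_fps cosh_root_fps"

definition sinh_root :: "complex \<Rightarrow> complex" where
  "sinh_root = eval_fps sinh_root_fps"

lemma cosh_root_fps_sums_cosh: "(\<lambda>k. fps_nth cosh_root_fps k * (w\<^sup>2) ^ k) sums cosh w"
proof -
  let ?f = "\<lambda>n. if even n then w ^ n /\<^sub>R fact n else 0"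
  have "(\<lambda>k. ?f (2 * k)) sums cosh w"
    using cosh_converges[of w]
    by (subst sums_mono_reindex) (auto simp: strict_mono_def elim!: evenE)
  also have "(\<lambda>k. ?f (2 * k)) = (\<lambda>k. fps_nth cosh_root_fps k * (w\<^sup>2) ^ k)"
    by (simp add: cosh_root_fps_def scaleR_conv_of_real power_mult divide_simps fun_eq_iff)
  finally show ?thesis .
qed

lemma sinh_root_fps_sums_sinh:
  "(\<lambda>k. w * (fps_nth sinh_root_fps k * (w\<^sup>2) ^ k)) sums sinh w"
proof -
  let ?f = "\<lambda>n. if even n then 0 else w ^ n /\<^sub>R fact n"
  have "(\<lambda>k. ?f (2 * k + 1)) sums sinh w"
    using sinh_converges[of w]
    by (subst sums_mono_reindex) (auto simp: strict_mono_def elim!: oddE)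
  also have "(\<lambda>k. ?f (2 * k + 1)) = (\<lambda>k. w * (fps_nth sinh_root_fps k * (w\<^sup>2) ^ k))"
    by (simp add: sinh_root_fps_def scaleR_conv_of_real power_mult divide_simps fun_eq_iff)
  finally show ?thesis .
qed

lemma summable_cosh_root_fps: "summable (\<lambda>k. fps_nth cosh_root_fps k * z ^ k)"
  using sums_summable[OF cosh_root_fps_sums_cosh[of "csqrt z"]] by simp

lemma summable_sinh_root_fps: "summable (\<lambda>k. fps_nth sinh_root_fps k * z ^ k)"
proof (cases "z = 0")
  case False
  then show ?thesis
    using sums_summable[OF sinh_root_fps_sums_sinh[of "csqrt z"]]
    by (simp add: summable_cmult_iff)
qed simp

lemma cosh_root_sums: "(\<lambda>k. z ^ k / fact (2 * k)) sums cosh_root z"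
  using summable_sums[OF summable_cosh_root_fps[of z]]
  by (simp add: cosh_root_def eval_fps_def cosh_root_fps_def)

lemma sinh_root_sums: "(\<lambda>k. z ^ k / fact (2 * k + 1)) sums sinh_root z"
  using summable_sums[OF summable_sinh_root_fps[of z]]
  by (simp add: sinh_root_def eval_fps_def sinh_root_fps_def)

lemma conv_radius_cosh_root_fps [simp]: "fps_conv_radius cosh_root_fps = \<infinity>"
  unfolding fps_conv_radius_def
  by (rule conv_radius_inftyI'') (rule summable_cosh_root_fps)

lemma conv_radius_sinh_root_fps [simp]: "fps_conv_radius sinh_root_fps = \<infinity>"
  unfolding fps_conv_radius_def
  by (rule conv_radius_inftyI'') (rule summable_sinh_root_fps)

lemma cosh_root_holomorphic: "cosh_root holomorphic_on S"
  unfolding cosh_root_def by (intro holomorphic_intros) auto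

lemma sinh_root_holomorphic: "sinh_root holomorphic_on S"
  unfolding sinh_root_def by (intro holomorphic_intros) auto

lemma cosh_root_holomorphic_compose [holomorphic_intros]:
  "f holomorphic_on S \<Longrightarrow> (\<lambda>z. cosh_root (f z)) holomorphic_on S"
  using holomorphic_on_compose[OF _ cosh_root_holomorphic, of f S] by (simp add: o_def)

lemma sinh_root_holomorphic_compose [holomorphic_intros]:
  "f holomorphic_on S \<Longrightarrow> (\<lambda>z. sinh_root (f z)) holomorphic_on S"
  using holomorphic_on_compose[OF _ sinh_root_holomorphic, of f S] by (simp add: o_def)

lemma cosh_root_power2: "cosh_root (w\<^sup>2) = cosh w"
  using cosh_root_fps_sums_cosh[of w] by (simp add: cosh_root_def eval_fps_def sums_iff)

lemma sinh_root_power2: "w * sinh_root (w\<^sup>2) = sinh w"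
  using sums_unique[OF sinh_root_fps_sums_sinh[of w]] summable_sinh_root_fps[of "w\<^sup>2"]
  by (simp add: sinh_root_def eval_fps_def suminf_mult)

lemma cosh_root_0 [simp]: "cosh_root 0 = 1"
  using cosh_root_power2[of 0] by simp

lemma sinh_root_0 [simp]: "sinh_root 0 = 1"
  by (simp add: sinh_root_def eval_fps_at_0 sinh_root_fps_def)

text \<open>Hyperbolic Pythagoras at a square root of \<open>z\<close>. It is the source of
  \<open>det (exp A) = 1\<close> for traceless \<open>A\<close> and of the vanishing of
  \<open>sinh_root\<close> where \<open>cosh_root\<close> is -1.\<close>

lemma cosh_root_sinh_root: "(cosh_root z)\<^sup>2 - z * (sinh_root z)\<^sup>2 = 1"
proof -
  define w where "w = csqrt z"
  have "z = w\<^sup>2" by (simp add: w_def)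
  moreover have "(cosh w)\<^sup>2 - (w * sinh_root (w\<^sup>2))\<^sup>2 = 1"
    by (simp only: sinh_root_power2 hyperbolic_pythagoras)
  ultimately show ?thesis
    by (simp add: cosh_root_power2 power_mult_distrib)
qed

text \<open>The substitution of \<open>i * w\<close> for \<open>w\<close>; it turns exponentials of
  traceless matrices with determinant \<open>w^2\<close> into rotations.\<close>

lemma cosh_root_neg_power2: "cosh_root (- (w\<^sup>2)) = cos w"
  using cosh_root_power2[of "\<i> * w"] by (simp add: cos_conv_cosh power_mult_distrib)

lemma sinh_root_neg_power2: "w * sinh_root (- (w\<^sup>2)) = sin w"
  unfolding sin_conv_sinh sinh_root_power2[symmetric]
  by (simp add: power_mult_distrib) (simp flip: mult.assoc)

lemma sinh_root_eq_0_if_cosh_root_minus_one: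
  assumes "cosh_root z = -1"
  shows "sinh_root z = 0"
proof -
  have "z * (sinh_root z)\<^sup>2 = 0" using cosh_root_sinh_root[of z] assms by simp
  moreover have "z \<noteq> 0" using assms by auto
  ultimately show ?thesis by simp
qed

text \<open>Only nonvanishing matters: it makes \<open>cosh_root\<close> invertible near 0, which
  yields the local logarithm below.\<close>

lemma deriv_cosh_root_0: "deriv cosh_root 0 = 1 / 2"
proof -
  have "(cosh_root has_field_derivative eval_fps (fps_deriv cosh_root_fps) 0) (at 0)"
    unfolding cosh_root_def by (rule has_field_derivative_eval_fps) simp
  then show ?thesis
    by (simp add: DERIV_imp_deriv eval_fps_at_0 cosh_root_fps_def)
qed

section \<open>Scalar matrices and the exponential of traceless 2 x 2 matrices\<close>

lemma matrix_mult_mat_nth: "(mat z ** A) $ i $ j = z * A $ i $ j" for A :: "complex^'n^'n"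
  by (simp add: matrix_matrix_mult_def mat_def if_distrib[of "\<lambda>x. x * _"] cong: if_cong)

text \<open>Complex multiples of a matrix are written \<open>mat z ** A\<close> throughout; this
  links them to the real scaling in \<open>magnus_coeffs\<close>.\<close>

lemma scaleR_eq_mat_mult: "t *\<^sub>R A = mat (complex_of_real t) ** A" for A :: "complex^'n^'n"
  by (simp add: vec_eq_iff matrix_mult_mat_nth) (simp add: scaleR_conv_of_real)

lemma mat_mult_mat: "mat a ** (mat b :: complex^'n^'n) = mat (a * b)"
  by (simp add: vec_eq_iff matrix_mult_mat_nth) (simp add: mat_def)

lemma mat_mult_commute: "A ** mat z = mat z ** A" for A :: "complex^'n^'n"
  by (simp add: vec_eq_iff matrix_mult_mat_nth)
     (simp add: matrix_matrix_mult_def mat_def if_distrib[of "\<lambda>x. _ * x"] mult.commute cong: if_cong)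

lemma trace_mat_mult: "trace (mat z ** A) = z * trace A" for A :: "complex^'n^'n"
  by (simp add: trace_def matrix_mult_mat_nth sum_distrib_left)

lemma det_mat_mult_2: "det (mat z ** A) = z\<^sup>2 * det A" for A :: "complex^2^2"
  by (simp add: det_2 matrix_mult_mat_nth power2_eq_square algebra_simps)

lemma matrix_power_of_square:
  fixes A :: "complex^'n^'n"
  assumes "A ** A = mat d"
  shows "matrix_power A (2 * k) = mat (d ^ k)" "matrix_power A (2 * k + 1) = mat (d ^ k) ** A"
proof -
  show *: "matrix_power A (2 * k) = mat (d ^ k)" for k
    unfolding matrix_power_def
    by (induction k) (simp_all add: matrix_mul_assoc assms mat_mult_mat)
  show "matrix_power A (2 * k + 1) = mat (d ^ k) ** A"
    using *[of k] by (simp add: matrix_power_def mat_mult_commute)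
qed

lemma matrix_sumsI:
  fixes f :: "nat \<Rightarrow> complex^'n^'m"
  assumes "\<And>i j. (\<lambda>n. f n $ i $ j) sums (s $ i $ j)"
  shows "f sums s"
  using assms unfolding sums_def by (intro vec_tendstoI) simp

text \<open>Even powers of \<open>A\<close> are scalar and odd powers are scalar multiples of
  \<open>A\<close>, so the exponential series splits, entry by entry, into the two series
  above.\<close>

lemma matrix_exp_of_square:
  fixes A :: "complex^'n^'n"
  assumes "A ** A = mat d"
  shows "matrix_exp A = mat (cosh_root d) + mat (sinh_root d) ** A"
proof -
  have "(\<lambda>k. (1 / fact k) *\<^sub>R matrix_power A k) sums (mat (cosh_root d) + mat (sinh_root d) ** A)"
  proof (rule matrix_sumsI)
    fix i j
    let ?p = "\<lambda>k. ((1 / fact k) *\<^sub>R matrix_power A k) $ i $ j"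
    let ?e = "mat 1 $ i $ j :: complex"
    have m: "mat z $ i $ j = z * ?e" for z :: complex by (simp add: mat_def)
    have "(\<lambda>k. ?p (2 * k)) = (\<lambda>k. d ^ k / fact (2 * k) * ?e)"
      by (simp only: matrix_power_of_square[OF assms] vector_scaleR_component m[of "d ^ _"])
         (simp add: scaleR_conv_of_real divide_simps)
    moreover have "(\<lambda>k. d ^ k / fact (2 * k) * ?e) sums (cosh_root d * ?e)"
      by (intro sums_mult2 cosh_root_sums)
    \<comment> \<open>The trivially true condition presents the series as the even part of a series
      padded with zeros at odd indices, ready for \<open>sums_mono_reindex\<close>.\<close>
    ultimately have "(\<lambda>k. (if even (2*k) then ?p (2*k) else 0)) sums (cosh_root d * ?e)"
      by simp
    then have even: "(\<lambda>n. if even n then ?p n else 0) sums (cosh_root d * ?e)"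
      by (subst (asm) sums_mono_reindex) (auto simp: strict_mono_def elim!: evenE)
    have "(\<lambda>k. ?p (2 * k + 1)) = (\<lambda>k. d ^ k / fact (2 * k + 1) * A $ i $ j)"
      by (simp only: matrix_power_of_square[OF assms] vector_scaleR_component matrix_mult_mat_nth)
         (simp add: scaleR_conv_of_real divide_simps)
    moreover have "(\<lambda>k. d ^ k / fact (2 * k + 1) * A $ i $ j) sums (sinh_root d * A $ i $ j)"
      by (intro sums_mult2 sinh_root_sums)
    ultimately have "(\<lambda>k. (if even (2*k+1) then 0 else ?p (2*k+1))) sums (sinh_root d * A $ i $ j)"
      by simp
    then have "(\<lambda>n. if even n then 0 else ?p n) sums (sinh_root d * A $ i $ j)"
      by (subst (asm) sums_mono_reindex) (auto simp: strict_mono_def elim!: oddE)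
    from sums_add[OF even this]
    have "?p sums (cosh_root d * ?e + sinh_root d * A $ i $ j)"
      by (simp add: if_distrib cong: if_cong)
    then show "?p sums ((mat (cosh_root d) + mat (sinh_root d) ** A) $ i $ j)"
      by (simp add: matrix_mult_mat_nth m[of "cosh_root d"])
  qed
  then show ?thesis
    unfolding matrix_exp_def by (simp add: sums_iff)
qed

text \<open>Cayley-Hamilton, with the linear term gone.\<close>

lemma traceless_mult_self:
  fixes A :: "complex^2^2"
  assumes "trace A = 0"
  shows "A ** A = mat (- det A)"
proof -
  have "A $ 2 $ 2 = - A $ 1 $ 1"
    using assms by (simp add: trace_def sum_2 add_eq_0_iff)
  then show ?thesis
    by (simp add: vec_eq_iff forall_2 matrix_matrix_mult_def mat_def sum_2 det_2 algebra_simps)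
qed

lemma matrix_exp_traceless:
  fixes A :: "complex^2^2"
  assumes "trace A = 0"
  shows "matrix_exp A = mat (cosh_root (- det A)) + mat (sinh_root (- det A)) ** A"
  by (intro matrix_exp_of_square traceless_mult_self assms)

text \<open>The obstruction: a traceless \<open>L\<close> with \<open>trace (exp L) = -2\<close> has the two different
  eigenvalues \<open>\<plusminus>k\<pi>\<i>\<close> with \<open>k\<close> odd, so it is diagonalisable and \<open>exp L = -1\<close>.\<close>

lemma matrix_exp_eq_minus_one:
  fixes L :: "complex^2^2"
  assumes "trace L = 0" and "trace (matrix_exp L) = - 2"
  shows "matrix_exp L = mat (-1)"
proof -
  have "2 * cosh_root (- det L) + sinh_root (- det L) * trace L = - 2"
    using assms(2) unfolding matrix_exp_traceless[OF assms(1)]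
    by (simp add: trace_def sum_2 matrix_mult_mat_nth algebra_simps) (simp add: mat_def)
  then have c: "cosh_root (- det L) = -1"
    using assms(1) by simp
  show ?thesis
    using sinh_root_eq_0_if_cosh_root_minus_one[OF c]
    by (simp add: matrix_exp_traceless[OF assms(1)] c)
qed

lemma det_matrix_exp_traceless:
  fixes A :: "complex^2^2"
  assumes "trace A = 0"
  shows "det (matrix_exp A) = 1"
proof -
  have a: "A $ 2 $ 2 = - A $ 1 $ 1"
    using assms by (simp add: trace_def sum_2 add_eq_0_iff)
  define c where "c = cosh_root (- det A)"
  define s where "s = sinh_root (- det A)"
  have "c\<^sup>2 + det A * s\<^sup>2 = 1"
    using cosh_root_sinh_root[of "- det A"] by (simp add: c_def s_def)
  then show ?thesis
    unfolding matrix_exp_traceless[OF assms] c_def[symmetric] s_def[symmetric]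
    by (simp add: det_2 matrix_mult_mat_nth a) (simp add: mat_def power2_eq_square algebra_simps)
qed

section \<open>Eigenvalues and a local holomorphic principal logarithm\<close>

lemma eigenvalue_traceless_square:
  fixes L :: "complex^2^2"
  assumes "trace L = 0" and "matrix_eigenvalue L z"
  shows "z\<^sup>2 = - det L"
proof -
  obtain v where v: "v \<noteq> 0" "L *v v = z *s v"
    using assms(2) by (auto simp: matrix_eigenvalue_def)
  have "L *v (L *v v) = z\<^sup>2 *s v"
    by (simp add: v(2) vector_scalar_commute power2_eq_square)
  moreover have "L *v (L *v v) = (- det L) *s v"
    by (simp add: matrix_vector_mul_assoc traceless_mult_self[OF assms(1)])
       (simp add: vec_eq_iff matrix_vector_mult_def mat_def forall_2 sum_2)
  ultimately have "z\<^sup>2 *s v = (- det L) *s v" by simp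
  then show ?thesis using v(1) by (simp only: vector_mul_rcancel) simp
qed

lemma eigenvalue_char_poly_2:
  fixes M :: "complex^2^2"
  assumes "matrix_eigenvalue M z"
  shows "z\<^sup>2 - trace M * z + det M = 0"
proof -
  \<comment> \<open>Subtracting half the trace reduces to the traceless case; it shifts every
    eigenvalue by the same amount.\<close>
  let ?N = "M - mat (trace M / 2)"
  have tr: "trace ?N = 0" by (simp add: trace_def sum_2) (simp add: mat_def)
  obtain v where v: "v \<noteq> 0" "M *v v = z *s v"
    using assms by (auto simp: matrix_eigenvalue_def)
  have "?N *v v = (z - trace M / 2) *s v"
    by (simp add: matrix_vector_mult_diff_rdistrib v(2) vector_ssub_ldistrib)
       (simp add: vec_eq_iff matrix_vector_mult_def mat_def forall_2 sum_2 algebra_simps)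
  then have "matrix_eigenvalue ?N (z - trace M / 2)"
    using v(1) by (auto simp: matrix_eigenvalue_def)
  moreover have "- det ?N = (trace M / 2)\<^sup>2 - det M"
    by (simp add: det_2 trace_def sum_2) (simp add: mat_def power2_eq_square field_simps)
  ultimately have "(z - trace M / 2)\<^sup>2 = (trace M / 2)\<^sup>2 - det M"
    using eigenvalue_traceless_square[OF tr] by metis
  then show ?thesis by (simp add: power2_diff) (simp add: algebra_simps)
qed

text \<open>At a real \<open>r \<le> 0\<close> the real part of the characteristic polynomial is
  \<open>r^2 - 2 * x * r + 1\<close> with \<open>x > 0\<close>, hence at least 1.\<close>

lemma unimodular_eigenvalue_not_nonpos:
  fixes M :: "complex^2^2"
  assumes "det M = 1" and "norm (trace M / 2 - 1) < 1" and "matrix_eigenvalue M z"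
  shows "z \<notin> \<real>\<^sub>\<le>\<^sub>0"
proof
  assume "z \<in> \<real>\<^sub>\<le>\<^sub>0"
  then obtain r where r: "z = complex_of_real r" "r \<le> 0"
    by (auto elim: nonpos_Reals_cases)
  define x where "x = Re (trace M / 2)"
  have "\<bar>Re (trace M / 2 - 1)\<bar> < 1"
    using assms(2) abs_Re_le_cmod le_less_trans by blast
  then have "x > 0" by (simp add: x_def)
  have "Re (z\<^sup>2 - trace M * z + det M) = 0"
    using eigenvalue_char_poly_2[OF assms(3)] by simp
  then have "r\<^sup>2 - 2 * x * r + 1 = 0"
    using assms(1) by (simp add: r(1) x_def power2_eq_square)
  moreover have "x * r \<le> 0" using \<open>x > 0\<close> r(2) by (simp add: mult_nonneg_nonpos)
  ultimately show False using zero_le_power2[of r] by linarith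
qed

text \<open>A traceless \<open>L\<close> with \<open>exp L = M\<close> must satisfy
  \<open>cosh_root (- det L) = trace M / 2\<close>. Near \<open>t = 0\<close> this is solved for
  \<open>D = - det L\<close> by inverting \<open>cosh_root\<close> near 0, and \<open>L\<close> is
  then recovered from \<open>M = cosh_root D + sinh_root D * L\<close>.\<close>

lemma local_principal_log:
  fixes M :: "complex \<Rightarrow> complex^2^2"
  assumes hol: "\<And>i j. (\<lambda>t. M t $ i $ j) holomorphic_on UNIV"
    and M0: "M 0 = mat 1" and det: "\<And>t. det (M t) = 1"
  obtains r :: real and F :: "complex \<Rightarrow> complex^2^2" where "r > 0" "\<And>i j. (\<lambda>t. F t $ i $ j) holomorphic_on ball 0 r" "F 0 = 0"
    "\<And>t. t \<in> ball 0 r \<Longrightarrow> trace (F t) = 0"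
    "\<And>t. t \<in> ball 0 r \<Longrightarrow> is_principal_log (M t) (F t)"
proof -
  define C where "C = (\<lambda>t. (M t $ 1 $ 1 + M t $ 2 $ 2) / 2)"
  have C_trace: "C t = trace (M t) / 2" for t by (simp add: C_def trace_def sum_2)
  have holC: "C holomorphic_on S" for S
    unfolding C_def by (intro holomorphic_intros holomorphic_on_subset[OF hol]) auto
  have C0: "C 0 = 1" by (simp add: C_def M0 mat_def)
  have cont: "continuous_on UNIV cosh_root" "continuous_on UNIV sinh_root"
    by (intro holomorphic_on_imp_continuous_on cosh_root_holomorphic sinh_root_holomorphic)+
  \<comment> \<open>The first condition confines the eigenvalues of the logarithm, which are square
    roots of \<open>z\<close>, to the unit disc and so to the strip; the second permits division;
    the third keeps the eigenvalues of \<open>M\<close> off the nonpositive reals.\<close>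
  define S where "S = {z. norm z < 1 \<and> sinh_root z \<noteq> 0 \<and> norm (cosh_root z - 1) < 1}"
  have "open S"
    unfolding S_def using cont
    by (intro open_Collect_conj open_Collect_neq open_Collect_less continuous_intros) auto
  moreover have "0 \<in> S" by (simp add: S_def)
  ultimately obtain e where e: "e > 0" "ball 0 e \<subseteq> S" "open (cosh_root ` ball 0 e)"
      "inj_on cosh_root (ball 0 e)"
    using has_complex_derivative_locally_invertible[OF cosh_root_holomorphic[of S], of 0]
    by (auto simp: deriv_cosh_root_0)
  obtain g where g: "g holomorphic_on (cosh_root ` ball 0 e)"
      "\<And>z. z \<in> ball 0 e \<Longrightarrow> g (cosh_root z) = z"
    by (rule holomorphic_has_inverse[OF cosh_root_holomorphic open_ball e(4)]) blast
  have "open (C -` (cosh_root ` ball 0 e))"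
    by (intro open_vimage e(3) holomorphic_on_imp_continuous_on holC)
  moreover have "0 \<in> C -` (cosh_root ` ball 0 e)"
    using e(1) C0 by (auto intro!: image_eqI[of _ _ 0])
  ultimately obtain r where r: "r > 0" "ball 0 r \<subseteq> C -` (cosh_root ` ball 0 e)"
    by (meson open_contains_ball)
  define D where "D = (\<lambda>t. g (C t))"
  have D: "D t \<in> S" "cosh_root (D t) = C t" if "t \<in> ball 0 r" for t
    using r(2) that g(2) e(2) unfolding D_def by fastforce+
  have holD: "D holomorphic_on ball 0 r"
    using holomorphic_on_compose_gen[OF holC g(1), of "ball 0 r"] r(2)
    by (auto simp: D_def o_def)
  define F where "F = (\<lambda>t. mat (1 / sinh_root (D t)) ** (M t - mat (C t)))"
  have tr: "trace (F t) = 0" for t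
    by (simp add: F_def trace_def sum_2 matrix_mult_mat_nth C_def)
       (simp add: mat_def flip: add_divide_distrib)
  have detF: "- det (F t) = D t" and expF: "matrix_exp (F t) = M t" if t: "t \<in> ball 0 r" for t
  proof -
    have s: "sinh_root (D t) \<noteq> 0" using D(1)[OF t] by (simp add: S_def)
    have "M t $ 1 $ 1 * M t $ 2 $ 2 - M t $ 1 $ 2 * M t $ 2 $ 1 = 1"
      using det[of t] by (simp add: det_2)
    then have "- det (M t - mat (C t)) = (C t)\<^sup>2 - 1"
      by (simp add: det_2 C_def) (simp add: mat_def power2_eq_square field_simps)
    also have "\<dots> = D t * (sinh_root (D t))\<^sup>2"
      using cosh_root_sinh_root[of "D t"] D(2)[OF t] by (simp add: algebra_simps)
    finally have "- det (M t - mat (C t)) = D t * (sinh_root (D t))\<^sup>2" .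
    moreover have "- det (F t) = - det (M t - mat (C t)) / (sinh_root (D t))\<^sup>2"
      by (simp add: F_def det_mat_mult_2 power_divide)
    ultimately show d: "- det (F t) = D t"
      using s by simp
    show "matrix_exp (F t) = M t"
      unfolding matrix_exp_traceless[OF tr] d D(2)[OF t]
      using s by (simp add: vec_eq_iff F_def matrix_mult_mat_nth)
  qed
  have "is_principal_log (M t) (F t)" if t: "t \<in> ball 0 r" for t
    unfolding is_principal_log_def
  proof (intro conjI allI impI expF t)
    fix z assume "matrix_eigenvalue (M t) z"
    then show "z \<notin> \<real>\<^sub>\<le>\<^sub>0"
      using unimodular_eigenvalue_not_nonpos[OF det] D[OF t]
      by (auto simp: S_def C_trace)
  next
    fix z assume "matrix_eigenvalue (F t) z"
    then have "z\<^sup>2 = D t" using eigenvalue_traceless_square[OF tr] detF[OF t] by metis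
    then have "(norm z)\<^sup>2 < 1" using D(1)[OF t] by (simp add: S_def norm_power[symmetric])
    then have "norm z < 1" by (simp add: power2_less_1_iff abs_square_less_1)
    then have "\<bar>Im z\<bar> < 1" using abs_Im_le_cmod[of z] by linarith
    then show "- pi < Im z" "Im z < pi" using pi_gt3 by linarith+
  qed
  moreover have "(\<lambda>t. F t $ i $ j) holomorphic_on ball 0 r" for i j
  proof -
    have "(\<lambda>t. 1 / sinh_root (D t) * (M t $ i $ j - C t * mat 1 $ i $ j)) holomorphic_on ball 0 r"
      using D(1) by (intro holomorphic_intros holD holC holomorphic_on_subset[OF hol])
        (auto simp: S_def)
    then show ?thesis
      by (simp add: F_def matrix_mult_mat_nth) (simp add: mat_def if_distrib cong: if_cong)
  qed
  moreover have "F 0 = 0"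
    by (simp add: F_def M0 C0)
  ultimately show ?thesis using that[of r F] r(1) tr by blast
qed

section \<open>The divergence criterion\<close>

lemma matrix_exp_mat_mult_holomorphic:
  fixes A :: "complex^2^2"
  assumes "trace A = 0"
  shows "(\<lambda>t. matrix_exp (mat t ** A) $ i $ j) holomorphic_on S"
proof -
  have tr: "trace (mat t ** A) = 0" for t
    using assms by (simp add: trace_mat_mult)
  have "matrix_exp (mat t ** A) $ i $ j =
      cosh_root (- (t\<^sup>2 * det A)) * mat 1 $ i $ j + sinh_root (- (t\<^sup>2 * det A)) * (t * A $ i $ j)" for t
    by (simp add: matrix_exp_traceless[OF tr] det_mat_mult_2 matrix_mult_mat_nth) (simp add: mat_def)
  then show ?thesis by (simp only:) (intro holomorphic_intros)
qed

lemma conv_radius_matrix_nth_ge: "conv_radius \<mu> \<le> conv_radius (\<lambda>n. \<mu> n $ i $ j)"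
  for \<mu> :: "nat \<Rightarrow> complex^'n^'m"
proof -
  have "norm (\<mu> n $ i $ j) \<le> norm (\<mu> n)" for n
    using Finite_Cartesian_Product.norm_nth_le[of "\<mu> n $ i" j] Finite_Cartesian_Product.norm_nth_le[of "\<mu> n" i] by linarith
  then have "limsup (\<lambda>n. ereal (root n (norm (\<mu> n $ i $ j)))) \<le> limsup (\<lambda>n. ereal (root n (norm (\<mu> n))))"
    by (intro Limsup_mono eventually_mono[OF eventually_gt_at_top[of 0]]) simp
  \<comment> \<open>Inversion of extended reals is antitone only on nonnegative arguments.\<close>
  moreover have "0 \<le> limsup (\<lambda>n. ereal (root n (norm (\<mu> n $ i $ j))))"
    by (intro le_Limsup) (auto simp: real_root_ge_zero)
  ultimately show ?thesis
    unfolding conv_radius_def by (intro ereal_inverse_antimono)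
qed

text \<open>Although \<open>magnus_coeffs\<close> speaks of real \<open>t\<close>, the coefficients
  are read off a logarithm holomorphic on a complex disc, so a complex \<open>t0\<close> obstructs
  convergence as well.\<close>

lemma magnus_divergent:
  fixes A B :: "complex^2^2" and t0 :: complex
  assumes tr: "trace A = 0" "trace B = 0" and t0: "norm t0 < 1"
    and tr_eq: "trace (matrix_exp (mat t0 ** A) ** matrix_exp (mat t0 ** B)) = - 2"
    and neq: "matrix_exp (mat t0 ** A) ** matrix_exp (mat t0 ** B) \<noteq> mat (-1)"
  shows "\<exists>\<mu>. magnus_coeffs A B \<mu> \<and> \<not> summable \<mu> \<and> conv_radius \<mu> < 1"
proof -
  define M where "M = (\<lambda>t. matrix_exp (mat t ** A) ** matrix_exp (mat t ** B))"
  have trt: "trace (mat t ** A) = 0" "trace (mat t ** B) = 0" for t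
    using tr by (simp_all add: trace_mat_mult)
  have holM: "(\<lambda>t. M t $ i $ j) holomorphic_on S" for i j S
  proof -
    have "(\<lambda>t. \<Sum>k\<in>UNIV. matrix_exp (mat t ** A) $ i $ k * matrix_exp (mat t ** B) $ k $ j) holomorphic_on S"
      by (intro holomorphic_intros matrix_exp_mat_mult_holomorphic tr)
    then show ?thesis by (simp add: M_def matrix_matrix_mult_def)
  qed
  have M0: "M 0 = mat 1"
    using trt[of 0] by (simp add: M_def matrix_exp_traceless det_2)
  have detM: "det (M t) = 1" for t
    by (simp add: M_def det_mul det_matrix_exp_traceless trt)
  obtain r :: real and F :: "complex \<Rightarrow> complex^2^2" where F: "r > 0"
      "\<And>i j. (\<lambda>t. F t $ i $ j) holomorphic_on ball 0 r" "F 0 = 0"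
      "\<And>t. t \<in> ball 0 r \<Longrightarrow> trace (F t) = 0"
      "\<And>t. t \<in> ball 0 r \<Longrightarrow> is_principal_log (M t) (F t)"
    using local_principal_log[OF holM M0 detM] by metis
  define P where "P = (\<lambda>i j. fps_expansion (\<lambda>t. F t $ i $ j) 0)"
  have P: "(\<lambda>t. F t $ i $ j) has_fps_expansion P i j" for i j
    unfolding P_def using F(1,2) by (intro has_fps_expansion_fps_expansion[of "ball 0 r"]) auto
  have F_sums: "(\<lambda>n. fps_nth (P i j) n * t ^ n) sums (F t $ i $ j)" if "t \<in> ball 0 r" for t i j
    using that F(2) by (intro has_fps_expansion_imp_sums_complex[OF P, where r = "ereal r"]) auto
  define \<mu> :: "nat \<Rightarrow> complex^2^2" where "\<mu> = (\<lambda>n. \<chi> i j. fps_nth (P i j) n)"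
  have "magnus_coeffs A B \<mu>"
    unfolding magnus_coeffs_def
  proof (intro conjI exI[of _ r] allI impI F(1))
    show "\<mu> 0 = 0"
      using has_fps_expansion_imp_0_eq_fps_nth_0[OF P] F(3)
      by (simp add: \<mu>_def vec_eq_iff)
    fix t :: real assume "\<bar>t\<bar> < r"
    then have t: "complex_of_real t \<in> ball 0 r" by simp
    have "(\<lambda>n. t ^ n *\<^sub>R \<mu> n) sums F (of_real t)"
    proof (rule matrix_sumsI)
      fix i j
      have "(t ^ n *\<^sub>R \<mu> n) $ i $ j = fps_nth (P i j) n * of_real t ^ n" for n
        by (simp add: \<mu>_def) (simp add: scaleR_conv_of_real)
      then show "(\<lambda>n. (t ^ n *\<^sub>R \<mu> n) $ i $ j) sums (F (of_real t) $ i $ j)"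
        using F_sums[OF t] by simp
    qed
    then show "\<exists>L. is_principal_log (matrix_exp (t *\<^sub>R A) ** matrix_exp (t *\<^sub>R B)) L \<and>
                 (\<lambda>n. t ^ n *\<^sub>R \<mu> n) sums L"
      using F(5)[OF t] by (auto simp: M_def scaleR_eq_mat_mult)
  qed
  \<comment> \<open>Stated for entries because both \<open>conv_radius \<mu> \<ge> 1\<close> and
    summability of \<open>\<mu>\<close> imply these bounds; one contradiction refutes both.\<close>
  moreover have diverges: False if ge1: "\<And>i j. conv_radius (\<lambda>n. \<mu> n $ i $ j) \<ge> 1"
  proof -
    define G :: "complex \<Rightarrow> complex^2^2" where "G = (\<lambda>t. \<chi> i j. eval_fps (P i j) t)"
    have holG: "(\<lambda>t. G t $ i $ j) holomorphic_on ball 0 1" for i j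
    proof -
      have "ereal 1 \<le> fps_conv_radius (P i j)"
        using ge1[of i j] by (simp add: \<mu>_def fps_conv_radius_def one_ereal_def)
      then have "ereal (norm z) < fps_conv_radius (P i j)" if "norm z < 1" for z :: complex
        using that by (metis less_ereal.simps(1) order.strict_trans2)
      then have "ball 0 1 \<subseteq> eball (0::complex) (fps_conv_radius (P i j))"
        by (auto simp: in_eball_iff)
      then show ?thesis unfolding G_def by (simp add: holomorphic_on_eval_fps)
    qed
    define s where "s = min r 1"
    have s: "0 < s" "ball 0 s \<subseteq> ball (0::complex) 1" "ball 0 s \<subseteq> ball (0::complex) r"
      using F(1) by (auto simp: s_def)
    have GF: "G t = F t" if "t \<in> ball 0 s" for t
      using F_sums that s(3) by (auto simp: G_def vec_eq_iff eval_fps_def sums_iff)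
    \<comment> \<open>Identity theorem: agreement near 0 reaches \<open>t0\<close> inside the unit
      disc.\<close>
    have continuation: "f t0 = g t0"
      if "f holomorphic_on ball 0 1" "g holomorphic_on ball 0 1" "\<And>t. t \<in> ball 0 s \<Longrightarrow> f t = g t"
      for f g :: "complex \<Rightarrow> complex"
      by (rule analytic_continuation_open[of "ball 0 s" "ball 0 1" f g])
         (use s that t0 in auto)
    have "(\<lambda>t. G t $ 1 $ 1 + G t $ 2 $ 2) t0 = (\<lambda>_. 0) t0"
    proof (rule continuation)
      show "G t $ 1 $ 1 + G t $ 2 $ 2 = 0" if "t \<in> ball 0 s" for t
        using F(4)[of t] that s(3) by (auto simp: GF trace_def sum_2)
    qed (intro holomorphic_intros holG)+
    then have trG: "trace (G t0) = 0" by (simp add: trace_def sum_2)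
    \<comment> \<open>\<open>H\<close> is the closed form of \<open>matrix_exp (G t)\<close> for
      traceless \<open>G t\<close>; in this form its entries are visibly holomorphic, so it can be
      continued from \<open>ball 0 s\<close> to \<open>t0\<close>.\<close>
    define H where "H = (\<lambda>t. mat (cosh_root (- det (G t))) + mat (sinh_root (- det (G t))) ** G t)"
    have "H t0 $ i $ j = M t0 $ i $ j" for i j
    proof (rule continuation)
      have "(\<lambda>t. cosh_root (- det (G t)) * mat 1 $ i $ j + sinh_root (- det (G t)) * G t $ i $ j)
          holomorphic_on ball 0 1"
        unfolding det_2 by (intro holomorphic_intros holG)
      then show "(\<lambda>t. H t $ i $ j) holomorphic_on ball 0 1"
        by (simp add: H_def matrix_mult_mat_nth) (simp add: mat_def if_distrib cong: if_cong)
      fix t :: complex assume t: "t \<in> ball 0 s"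
      then have "t \<in> ball 0 r" using s(3) by blast
      then have "H t = M t"
        using F(4,5)[of t] GF[OF t]
        by (simp add: H_def is_principal_log_def flip: matrix_exp_traceless)
      then show "H t $ i $ j = M t $ i $ j" by simp
    qed (rule holM)
    then have "matrix_exp (G t0) = M t0"
      unfolding matrix_exp_traceless[OF trG] H_def by (simp add: vec_eq_iff)
    then show False
      using matrix_exp_eq_minus_one[OF trG] tr_eq neq by (simp add: M_def)
  qed
  moreover have "\<not> conv_radius \<mu> \<ge> 1"
    using diverges conv_radius_matrix_nth_ge[of \<mu>] by (meson order_trans)
  moreover have "\<not> summable \<mu>"
  proof
    assume "summable \<mu>"
    then have "summable (\<lambda>n. \<mu> n $ i $ j * 1 ^ n)" for i j
      by (simp add: summable_vec_nth)
    from conv_radius_geI[OF this]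
    have "1 \<le> conv_radius (\<lambda>n. \<mu> n $ i $ j)" for i j by (simp add: one_ereal_def)
    then show False using diverges by blast
  qed
  ultimately show ?thesis by (auto simp: not_le)
qed

section \<open>Rotations, operator norms and traces of products\<close>

lemma matrix_exp_rotation:
  fixes A :: "complex^2^2"
  assumes "trace A = 0" and "det A = w\<^sup>2" and "w \<noteq> 0"
  shows "matrix_exp (mat t ** A) = mat (cos (w * t)) + mat (sin (w * t) / w) ** A"
proof -
  have tr: "trace (mat t ** A) = 0"
    using assms(1) by (simp add: trace_mat_mult)
  have d: "det (mat t ** A) = (w * t)\<^sup>2"
    by (simp add: det_mat_mult_2 assms(2) power_mult_distrib)
  have "sinh_root (- (w * t)\<^sup>2) * t = sin (w * t) / w"
    using sinh_root_neg_power2[of "w * t"] assms(3) by (simp add: field_simps)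
  then show ?thesis
    unfolding matrix_exp_traceless[OF tr] d cosh_root_neg_power2
    by (simp add: matrix_mul_assoc mat_mult_mat)
qed

lemma onorm_eqI:
  fixes f :: "'a::euclidean_space \<Rightarrow> 'b::real_normed_vector"
  assumes lin: "linear f" and le: "\<And>v. norm (f v) \<le> c * norm v"
    and "v \<noteq> 0" "norm (f v) = c * norm v"
  shows "onorm f = c"
proof (rule antisym)
  show "onorm f \<le> c" by (rule onorm_le) (rule le)
  have "norm (f v) / norm v \<le> onorm f"
    using lin by (intro le_onorm) (simp add: linear_conv_bounded_linear)
  then show "c \<le> onorm f" using assms(3,4) by simp
qed

text \<open>The mixed terms are multiples of \<open>A\<close> and \<open>B\<close> and contribute no
  trace.\<close>

lemma trace_rotation_product:
  fixes A B :: "complex^2^2"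
  assumes "trace A = 0" and "trace B = 0"
  shows "trace ((mat a + mat b ** A) ** (mat c + mat d ** B)) = 2 * a * c + b * d * trace (A ** B)"
proof -
  have "A $ 2 $ 2 = - A $ 1 $ 1" "B $ 2 $ 2 = - B $ 1 $ 1"
    using assms by (simp_all add: trace_def sum_2 add_eq_0_iff)
  then show ?thesis
    by (simp add: trace_def sum_2 matrix_matrix_mult_def mat_def) (simp add: algebra_simps)
qed

section \<open>Parameters at which the trace equals -2\<close>

lemma exists_elliptic_param:
  fixes n1 w \<kappa> :: real
  assumes "n1 > 0" "w > 0" "n1 + w > pi" "\<kappa> \<ge> 1"
  obtains t where "0 < t" "t < 1" "sin (n1 * t) > 0" "sin (w * t) > 0"
    "cos (n1 * t) * cos (w * t) - \<kappa> * (sin (n1 * t) * sin (w * t)) = -1"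
proof -
  define T where "T = pi / (n1 + w)"
  define f where "f = (\<lambda>t. cos (n1 * t) * cos (w * t) - \<kappa> * (sin (n1 * t) * sin (w * t)))"
  have T: "0 < T" "T < 1" "n1 * T + w * T = pi"
    using assms by (simp_all add: T_def flip: distrib_right add_divide_distrib)
  then have wT: "w * T = pi - n1 * T" by linarith
  \<comment> \<open>At \<open>T\<close> the two angles are supplementary, which pushes
    \<open>f\<close> down to -1 or below, while \<open>f 0 = 1\<close>.\<close>
  have "f T = - (cos (n1 * T))\<^sup>2 - \<kappa> * (sin (n1 * T))\<^sup>2"
    by (simp add: f_def wT power2_eq_square)
  also have "\<dots> = - 1 - (\<kappa> - 1) * (sin (n1 * T))\<^sup>2"
    by (simp add: cos_squared_eq left_diff_distrib)
  finally have "f T = - 1 - (\<kappa> - 1) * (sin (n1 * T))\<^sup>2" .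
  then have "f T \<le> -1" using assms(4) by simp
  moreover have "f 0 = 1" by (simp add: f_def)
  moreover have "\<forall>x. 0 \<le> x \<and> x \<le> T \<longrightarrow> isCont f x"
    unfolding f_def by (intro allI impI continuous_intros)
  ultimately obtain t where t: "0 \<le> t" "t \<le> T" "f t = -1"
    using IVT2[of f T "-1" 0] T(1) by auto
  then have "t > 0" using \<open>f 0 = 1\<close> by (cases "t = 0") auto
  \<comment> \<open>Both angles are positive and sum to \<open>pi\<close> at \<open>T\<close>, so
    each stays below \<open>pi\<close> up to \<open>T\<close>.\<close>
  have "n1 * t \<le> n1 * T" "w * t \<le> w * T"
    using t(2) assms by simp_all
  moreover have "n1 * T > 0" "w * T > 0" using T assms by simp_all
  ultimately have "n1 * t < pi" "w * t < pi" using T(3) by linarith+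
  then have "sin (n1 * t) > 0" "sin (w * t) > 0"
    using \<open>t > 0\<close> assms by (auto intro!: sin_gt_zero)
  then show ?thesis using that[of t] t \<open>t > 0\<close> T by (simp add: f_def)
qed

text \<open>For real \<open>t\<close> the left side is a convex combination, with weights
  \<open>(1 + k) / 2\<close> and \<open>(1 - k) / 2\<close>, of the cosines of the sum and the
  difference of the angles; it is -1 only where both sines vanish. So \<open>t\<close> has to be
  complex. At \<open>k = 1\<close> there is the zero \<open>T\<close>, and Hurwitz's theorem keeps a
  zero nearby for some \<open>k < 1\<close>.\<close>

lemma exists_complex_rotation_param:
  fixes n1 n2 :: real
  assumes "n1 > 0" "n2 > 0" "n1 + n2 > pi"
  obtains k :: real and t :: complex where "0 \<le> k" "k < 1" "norm t < 1" "sin (n2 * t) \<noteq> 0"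
    "cos (n1 * t) * cos (n2 * t) - k * (sin (n1 * t) * sin (n2 * t)) = -1"
proof -
  define T where "T = pi / (n1 + n2)"
  have T: "0 < T" "T < 1" "n1 * T + n2 * T = pi"
    using assms by (simp_all add: T_def flip: distrib_right add_divide_distrib)
  \<comment> \<open>Open conditions that hold at \<open>T\<close> and therefore at every zero close
    to it.\<close>
  define S where "S = {t :: complex. norm t < 1 \<and> sin (n2 * t) \<noteq> 0}"
  have "open S"
    unfolding S_def
    by (intro open_Collect_conj open_Collect_neq open_Collect_less continuous_intros)
  moreover have "complex_of_real T \<in> S"
  proof -
    have "n1 * T > 0" "n2 * T > 0" using T(1) assms by simp_all
    then have "sin (n2 * T) > 0" using T(3) by (intro sin_gt_zero) linarith+
    moreover have "sin (complex_of_real n2 * T) = complex_of_real (sin (n2 * T))"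
      by (simp add: sin_of_real flip: of_real_mult)
    ultimately show ?thesis using T by (simp add: S_def)
  qed
  ultimately obtain r where r: "r > 0" "ball (complex_of_real T) r \<subseteq> S"
    by (meson open_contains_ball)
  define p where "p = (\<lambda>t::complex. sin (n1 * t) * sin (n2 * t))"
  define g where "g = (\<lambda>t::complex. cos (n1 * t) * cos (n2 * t) - p t + 1)"
  \<comment> \<open>\<open>k n\<close> rises from 0 towards 1 without reaching it, so
    \<open>G n\<close> tends to \<open>g\<close>.\<close>
  define k where "k = (\<lambda>n. 1 - inverse (real (Suc n)))"
  define G where "G = (\<lambda>n (t :: complex). cos (n1 * t) * cos (n2 * t) - k n * p t + 1)"
  have g_real: "g (complex_of_real x) = complex_of_real (cos (n1 * x + n2 * x) + 1)" for x
  proof -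
    have "cos (complex_of_real a * x) = complex_of_real (cos (a * x))"
      "sin (complex_of_real a * x) = complex_of_real (sin (a * x))" for a
      by (metis cos_of_real sin_of_real of_real_mult)+
    then show ?thesis by (simp add: g_def p_def cos_add)
  qed
  have g0: "g T = 0" unfolding g_real T(3) by simp
  have "\<exists>n t. t \<in> ball (complex_of_real T) r \<and> G n t = 0"
  proof (rule ccontr)
    assume nz: "\<not> (\<exists>n t. t \<in> ball (complex_of_real T) r \<and> G n t = 0)"
    have "g T \<noteq> 0"
    proof (rule Hurwitz_no_zeros[where S = "ball (complex_of_real T) r" and \<F> = G and g = g
          and ?z0.0 = "complex_of_real T"])
      show "G n holomorphic_on ball (complex_of_real T) r" for n
        unfolding G_def p_def by (intro holomorphic_intros)
      show "g holomorphic_on ball (complex_of_real T) r"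
        unfolding g_def p_def by (intro holomorphic_intros)
      show "\<not> g constant_on ball (complex_of_real T) r"
      proof
        assume "g constant_on ball (complex_of_real T) r"
        then obtain c where c: "\<And>t. t \<in> ball (complex_of_real T) r \<Longrightarrow> g t = c"
          by (auto simp: constant_on_def)
        \<comment> \<open>\<open>T - s\<close> stays in the ball and is nonnegative, so the total
          angle there lies in \<open>[0, pi)\<close>, where the cosine exceeds -1.\<close>
        define s where "s = min (r / 2) T"
        have s: "0 < s" "s < r" "s \<le> T" using r(1) T(1) by (auto simp: s_def)
        have "dist (complex_of_real T) (complex_of_real (T - s)) < r"
          using s by (simp add: dist_norm)
        then have "g (complex_of_real (T - s)) = 0"
          using c[of "complex_of_real (T - s)"] c[of "complex_of_real T"] r(1) g0 by simp
        then have "cos (n1 * (T - s) + n2 * (T - s)) + 1 = 0"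
          unfolding g_real of_real_eq_0_iff .
        moreover have "cos pi < cos (n1 * (T - s) + n2 * (T - s))"
        proof (rule cos_monotone_0_pi)
          have *: "n1 * (T - s) + n2 * (T - s) = pi - (n1 + n2) * s"
            using T(3) by (simp add: algebra_simps)
          show "n1 * (T - s) + n2 * (T - s) < pi"
            unfolding * using s assms by simp
          show "0 \<le> n1 * (T - s) + n2 * (T - s)"
            using s assms by (intro add_nonneg_nonneg mult_nonneg_nonneg) auto
        qed simp
        ultimately show False by simp
      qed
      fix K assume K: "compact K" "K \<subseteq> ball (complex_of_real T) r"
      have "bounded (p ` K)"
        unfolding p_def using K(1)
        by (intro compact_imp_bounded compact_continuous_image continuous_intros)
      then obtain B where B: "\<And>t. t \<in> K \<Longrightarrow> norm (p t) \<le> B"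
        by (auto simp: bounded_iff)
      show "uniform_limit K G g sequentially"
      proof (rule uniform_limitI)
        fix e :: real assume "e > 0"
        have "(\<lambda>n. inverse (real (Suc n)) * B) \<longlonglongrightarrow> 0 * B"
          by (intro tendsto_intros LIMSEQ_inverse_real_of_nat)
        then have "\<forall>\<^sub>F n in sequentially. inverse (real (Suc n)) * B < e"
          using \<open>e > 0\<close> by (intro order_tendstoD(2)[where y = 0]) auto
        then show "\<forall>\<^sub>F n in sequentially. \<forall>t\<in>K. dist (G n t) (g t) < e"
        proof eventually_elim
          case (elim n)
          have "dist (G n t) (g t) < e" if "t \<in> K" for t
          proof -
            have "G n t - g t = complex_of_real (inverse (real (Suc n))) * p t"
              by (simp add: G_def g_def k_def algebra_simps)
            then have "dist (G n t) (g t) = inverse (real (Suc n)) * norm (p t)"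
              by (simp only: dist_norm norm_mult norm_of_real) simp
            also have "\<dots> \<le> inverse (real (Suc n)) * B"
              using B[OF that] by (intro mult_left_mono) auto
            finally show ?thesis using elim by simp
          qed
          then show ?case by blast
        qed
      qed
    qed (use nz r(1) in auto)
    then show False using g0 by simp
  qed
  then obtain n t where t: "t \<in> ball (complex_of_real T) r" "G n t = 0" by blast
  show ?thesis
  proof (rule that[of "k n" t])
    show "0 \<le> k n" "k n < 1" by (simp_all add: k_def divide_simps)
    show "norm t < 1" "sin (n2 * t) \<noteq> 0" using t(1) r(2) by (auto simp: S_def)
    show "cos (n1 * t) * cos (n2 * t) - k n * (sin (n1 * t) * sin (n2 * t)) = -1"
      using t(2) by (simp add: G_def p_def add_eq_0_iff2)
  qed
qed

section \<open>The real and the skew-Hermitian examples\<close>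

lemma real_traceless_divergent:
  fixes n1 n2 :: real
  assumes "n1 > 0" and "n2 > 0" and "n1 + n2 > pi"
  shows "\<exists>A1 A2 :: real^2^2.
            trace A1 = 0 \<and> trace A2 = 0 \<and>
            onorm ((*v) A1) = n1 \<and> onorm ((*v) A2) = n2 \<and>
            (\<exists>\<mu>. magnus_coeffs (map_matrix complex_of_real A1) (map_matrix complex_of_real A2) \<mu> \<and>
                 \<not> summable \<mu> \<and> conv_radius \<mu> < 1)"
proof -
  \<comment> \<open>\<open>w\<close> is the angular speed of the second matrix: below its norm
    \<open>n2\<close>, yet large enough that \<open>n1 + w > pi\<close>.\<close>
  obtain w where w: "max 0 (pi - n1) < w" "w < n2"
    using dense[of "max 0 (pi - n1)" n2] assms by auto
  then have w_pos: "w > 0" and w_gt: "n1 + w > pi" by auto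
  \<comment> \<open>The choice makes \<open>det B = n2 * c = w^2\<close>, so that \<open>B\<close>
    generates an elliptic rotation of speed \<open>w\<close>.\<close>
  define c where "c = w\<^sup>2 / n2"
  have c: "c > 0" "n2 * c = w\<^sup>2" using w_pos assms by (simp_all add: c_def)
  have "w\<^sup>2 < n2\<^sup>2" using w_pos w(2) by (intro power_strict_mono) auto
  then have "n2 * c < n2 * n2" using c(2) by (simp add: power2_eq_square)
  then have "c < n2" using assms(2) by simp
  \<comment> \<open>This is the coefficient produced by
    \<open>trace (A ** B) = - n1 * (c + n2)\<close>. As \<open>w\<close> is the geometric mean of
    \<open>c\<close> and \<open>n2\<close>, it is at least 1.\<close>
  define \<kappa> where "\<kappa> = (c + n2) / (2 * w)"
  have "4 * w\<^sup>2 \<le> (c + n2)\<^sup>2"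
    using zero_le_power2[of "c - n2"] c(2) by (simp add: power2_eq_square algebra_simps)
  then have "(2 * w)\<^sup>2 \<le> (c + n2)\<^sup>2" by (simp add: power_mult_distrib)
  then have "2 * w \<le> c + n2"
    by (rule power2_le_imp_le) (use c assms in simp)
  then have "\<kappa> \<ge> 1" using w_pos by (simp add: \<kappa>_def)
  then obtain t where t: "0 < t" "t < 1" "sin (n1 * t) > 0" "sin (w * t) > 0"
      "cos (n1 * t) * cos (w * t) - \<kappa> * (sin (n1 * t) * sin (w * t)) = -1"
    using exists_elliptic_param[OF assms(1) w_pos w_gt] by blast
  define A :: "real^2^2" where "A = vector [vector [0, - n1], vector [n1, 0]]"
  define B :: "real^2^2" where "B = vector [vector [0, - n2], vector [c, 0]]"
  define A' where "A' = map_matrix complex_of_real A"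
  define B' where "B' = map_matrix complex_of_real B"
  have A'_nth: "A' $ 1 $ 1 = 0" "A' $ 1 $ 2 = - n1" "A' $ 2 $ 1 = n1" "A' $ 2 $ 2 = 0"
    by (simp_all add: A'_def A_def map_matrix_def)
  have B'_nth: "B' $ 1 $ 1 = 0" "B' $ 1 $ 2 = - n2" "B' $ 2 $ 1 = c" "B' $ 2 $ 2 = 0"
    by (simp_all add: B'_def B_def map_matrix_def)
  have tr: "trace A' = 0" "trace B' = 0" by (simp_all add: trace_def sum_2 A'_nth B'_nth)
  have det: "det A' = (complex_of_real n1)\<^sup>2" "det B' = (complex_of_real w)\<^sup>2"
    using c(2) by (simp_all add: det_2 A'_nth B'_nth power2_eq_square flip: of_real_mult)
  define E where "E = matrix_exp (mat (complex_of_real t) ** A') ** matrix_exp (mat (complex_of_real t) ** B')"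
  have E: "E = (mat (cos (n1 * t)) + mat (sin (n1 * t) / n1) ** A') **
      (mat (cos (w * t)) + mat (sin (w * t) / w) ** B')"
    using assms(1) w_pos by (simp add: E_def matrix_exp_rotation[OF tr(1) det(1)]
      matrix_exp_rotation[OF tr(2) det(2)] flip: of_real_mult cos_of_real sin_of_real)
  have "trace E = complex_of_real (2 * (cos (n1 * t) * cos (w * t) - \<kappa> * (sin (n1 * t) * sin (w * t))))"
    unfolding E trace_rotation_product[OF tr] using assms(1) w_pos
    by (simp add: trace_def sum_2 matrix_matrix_mult_def A'_nth B'_nth \<kappa>_def field_simps)
  then have trE: "trace E = - 2" by (simp only: t(5)) simp
  \<comment> \<open>Unequal diagonal entries rule out -1; the difference is nonzero because
    \<open>c < n2\<close> and both sines are positive.\<close>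
  have "E $ 2 $ 2 - E $ 1 $ 1 = complex_of_real (sin (n1 * t) * sin (w * t) * (c - n2) / w)"
    unfolding E using assms(1) w_pos
    by (simp add: sum_2 matrix_matrix_mult_def mat_def A'_nth B'_nth field_simps)
  moreover have "\<dots> \<noteq> 0"
    unfolding of_real_eq_0_iff using t \<open>c < n2\<close> w_pos by simp
  ultimately have "E $ 2 $ 2 \<noteq> E $ 1 $ 1" by (metis diff_self)
  then have "E \<noteq> mat (-1)" by (auto simp: mat_def)
  with trE have "\<exists>\<mu>. magnus_coeffs A' B' \<mu> \<and> \<not> summable \<mu> \<and> conv_radius \<mu> < 1"
    using t by (intro magnus_divergent[OF tr, of "complex_of_real t"]) (simp_all add: E_def)
  moreover have "trace A = 0" "trace B = 0"
    by (simp_all add: trace_def sum_2 A_def B_def)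
  moreover have "onorm ((*v) A) = n1"
  proof (rule onorm_eqI)
    have eq: "norm (A *v v) = n1 * norm v" for v
    proof -
      have "norm (A *v v) = sqrt (n1\<^sup>2 * ((v $ 1)\<^sup>2 + (v $ 2)\<^sup>2))"
        by (simp add: norm_vec_def L2_set_def sum_2 matrix_vector_mult_def A_def algebra_simps)
      then show ?thesis
        using assms(1) by (simp add: norm_vec_def L2_set_def sum_2 real_sqrt_mult)
    qed
    show "norm (A *v v) \<le> n1 * norm v" for v by (simp add: eq)
    show "norm (A *v axis 1 1) = n1 * norm (axis 1 1 :: real^2)" by (rule eq)
    show "axis 1 1 \<noteq> (0 :: real^2)" by (simp add: axis_eq_0_iff)
  qed simp
  moreover have "onorm ((*v) B) = n2"
  proof (rule onorm_eqI)
    have eq: "norm (B *v v) = sqrt ((n2 * v $ 2)\<^sup>2 + (c * v $ 1)\<^sup>2)" for v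
      by (simp add: norm_vec_def L2_set_def sum_2 matrix_vector_mult_def B_def)
    show "norm (B *v v) \<le> n2 * norm v" for v
    proof -
      \<comment> \<open>Since \<open>c < n2\<close>, the larger off-diagonal entry determines the
        norm, attained at the second basis vector.\<close>
      have "(c * v $ 1)\<^sup>2 \<le> (n2 * v $ 1)\<^sup>2"
        using c(1) \<open>c < n2\<close> by (simp add: power_mult_distrib mult_right_mono power_mono)
      then have "norm (B *v v) \<le> sqrt (n2\<^sup>2 * ((v $ 1)\<^sup>2 + (v $ 2)\<^sup>2))"
        unfolding eq by (simp add: algebra_simps)
      then show ?thesis
        using assms(2) by (simp add: norm_vec_def L2_set_def sum_2 real_sqrt_mult)
    qed
    show "norm (B *v axis 2 1) = n2 * norm (axis 2 1 :: real^2)"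
      using assms(2) by (simp add: eq) (simp add: axis_def)
    show "axis 2 1 \<noteq> (0 :: real^2)" by (simp add: axis_eq_0_iff)
  qed simp
  ultimately show ?thesis unfolding A'_def B'_def by blast
qed

lemma skew_hermitian_divergent:
  fixes n1 n2 :: real
  assumes "n1 > 0" and "n2 > 0" and "n1 + n2 > pi"
  shows "\<exists>A1 A2 :: complex^2^2.
            skew_hermitian A1 \<and> skew_hermitian A2 \<and>
            onorm ((*v) A1) = n1 \<and> onorm ((*v) A2) = n2 \<and>
            (\<exists>\<mu>. magnus_coeffs A1 A2 \<mu> \<and> \<not> summable \<mu> \<and> conv_radius \<mu> < 1)"
proof -
  obtain k :: real and t :: complex where k: "0 \<le> k" "k < 1"
      and t: "norm t < 1" "sin (n2 * t) \<noteq> 0"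
      "cos (n1 * t) * cos (n2 * t) - k * (sin (n1 * t) * sin (n2 * t)) = -1"
    using exists_complex_rotation_param[OF assms] by blast
  \<comment> \<open>\<open>R n a b\<close> is \<open>i * n\<close> times the combination of the
    Pauli matrices sigma_z and sigma_x with coefficients \<open>a\<close> and \<open>b\<close>; for
    a unit vector \<open>(a, b)\<close> it is \<open>n\<close> times a unitary matrix.\<close>
  define R :: "real \<Rightarrow> real \<Rightarrow> real \<Rightarrow> complex^2^2" where
    "R = (\<lambda>n a b. vector [vector [\<i> * n * a, \<i> * n * b], vector [\<i> * n * b, - \<i> * n * a]])"
  have R_nth: "R n a b $ 1 $ 1 = \<i> * n * a" "R n a b $ 1 $ 2 = \<i> * n * b"
    "R n a b $ 2 $ 1 = \<i> * n * b" "R n a b $ 2 $ 2 = - \<i> * n * a" for n a b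
    by (simp_all add: R_def)
  have skew: "skew_hermitian (R n a b)" for n a b
    by (simp add: skew_hermitian_def forall_2 R_nth)
  have tr: "trace (R n a b) = 0" for n a b
    by (simp add: trace_def sum_2 R_nth)
  have det: "det (R n a b) = (complex_of_real n)\<^sup>2" if "a\<^sup>2 + b\<^sup>2 = 1" for n a b
  proof -
    have "det (R n a b) = complex_of_real (n\<^sup>2 * (a\<^sup>2 + b\<^sup>2))"
      by (simp add: det_2 R_nth power2_eq_square algebra_simps)
    then show ?thesis by (simp only: that) simp
  qed
  have onorm_R: "onorm ((*v) (R n a b)) = n" if "n > 0" "a\<^sup>2 + b\<^sup>2 = 1" for n a b
  proof (rule onorm_eqI)
    have eq: "norm (R n a b *v v) = n * norm v" for v
    proof -
      have "(norm (R n a b *v v))\<^sup>2 = n\<^sup>2 * (a\<^sup>2 + b\<^sup>2) * (norm v)\<^sup>2"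
        by (simp add: norm_vec_def L2_set_def sum_2 matrix_vector_mult_def R_nth cmod_power2)
           (simp add: power2_eq_square algebra_simps)
      then have "(norm (R n a b *v v))\<^sup>2 = (n * norm v)\<^sup>2"
        by (simp add: that power_mult_distrib)
      then show ?thesis using that(1) by (simp add: power2_eq_iff_nonneg)
    qed
    show "norm (R n a b *v v) \<le> n * norm v" for v by (simp add: eq)
    show "norm (R n a b *v axis 1 1) = n * norm (axis 1 1 :: complex^2)" by (rule eq)
    show "axis 1 1 \<noteq> (0 :: complex^2)" by (simp add: axis_eq_0_iff)
  qed simp
  \<comment> \<open>\<open>(k, q)\<close> is the tilted unit axis: its inner product with
    \<open>(1, 0)\<close> is the \<open>k\<close> in the trace equation, and \<open>q\<close> is
    nonzero because \<open>k < 1\<close>.\<close>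
  define q where "q = sqrt (1 - k\<^sup>2)"
  have "k\<^sup>2 < 1" using k by (simp add: power_less_one_iff abs_square_less_1)
  then have q: "k\<^sup>2 + q\<^sup>2 = 1" "q \<noteq> 0" by (simp_all add: q_def)
  define E where "E = matrix_exp (mat t ** R n1 1 0) ** matrix_exp (mat t ** R n2 k q)"
  have det1: "det (R n1 1 0) = (complex_of_real n1)\<^sup>2" by (rule det) simp
  have E: "E = (mat (cos (n1 * t)) + mat (sin (n1 * t) / n1) ** R n1 1 0) **
      (mat (cos (n2 * t)) + mat (sin (n2 * t) / n2) ** R n2 k q)"
    using assms by (simp add: E_def matrix_exp_rotation[OF tr det1]
      matrix_exp_rotation[OF tr det[OF q(1)]])
  have "trace E = 2 * (cos (n1 * t) * cos (n2 * t) - k * (sin (n1 * t) * sin (n2 * t)))"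
    unfolding E trace_rotation_product[OF tr tr] using assms
    by (simp add: trace_def sum_2 matrix_matrix_mult_def R_nth field_simps)
  then have trE: "trace E = - 2" by (simp only: t(3)) simp
  \<comment> \<open>The first factor is diagonal with upper entry \<open>exp (i * n1 * t)\<close>,
    so this entry vanishes only if \<open>sin (n2 * t)\<close> or \<open>q\<close> does.\<close>
  have "E $ 1 $ 2 = exp (\<i> * (n1 * t)) * sin (n2 * t) * \<i> * q"
    unfolding E exp_Euler using assms
    by (simp add: sum_2 matrix_matrix_mult_def mat_def R_nth field_simps)
  then have "E $ 1 $ 2 \<noteq> 0" using t(2) q(2) by simp
  then have "E \<noteq> mat (-1)" by (auto simp: mat_def)
  with trE have "\<exists>\<mu>. magnus_coeffs (R n1 1 0) (R n2 k q) \<mu> \<and> \<not> summable \<mu> \<and> conv_radius \<mu> < 1"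
    using t(1) by (intro magnus_divergent[OF tr tr, of t]) (simp_all add: E_def)
  moreover have "onorm ((*v) (R n1 1 0)) = n1" "onorm ((*v) (R n2 k q)) = n2"
    using assms q(1) by (auto intro!: onorm_R)
  ultimately show ?thesis
    using skew by blast
qed

theorem theorem6p14:
  fixes n1 n2 :: real
  assumes "n1 > 0" and "n2 > 0" and "n1 + n2 > pi"
  shows "(\<exists>A1 A2 :: real^2^2.
            trace A1 = 0 \<and> trace A2 = 0 \<and>
            onorm ((*v) A1) = n1 \<and> onorm ((*v) A2) = n2 \<and>
            (\<exists>\<mu>. magnus_coeffs (map_matrix complex_of_real A1) (map_matrix complex_of_real A2) \<mu> \<and>
                 \<not> summable \<mu> \<and> conv_radius \<mu> < 1)) \<and>
         (\<exists>A1 A2 :: complex^2^2.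
            skew_hermitian A1 \<and> skew_hermitian A2 \<and>
            onorm ((*v) A1) = n1 \<and> onorm ((*v) A2) = n2 \<and>
            (\<exists>\<mu>. magnus_coeffs A1 A2 \<mu> \<and> \<not> summable \<mu> \<and> conv_radius \<mu> < 1))"
  using real_traceless_divergent[OF assms] skew_hermitian_divergent[OF assms] by (rule conjI)

end
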